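(* Let $t$ be an indeterminate and let the rational functions $\tau_n(t)$ be defined by $\tau_0(t)=1+t$, $\tau_{2n}(t)=\frac{1+t^{n+1}}{1+t^n}$ for $n>0$, and $\tau_{2n+1}(t)=\frac{t(1+t^n)}{1+t^{n+1}}$ for $n\ge 0$. Define polynomials $L_n(x,t)$ in $x$ (with coefficients rational in $t$) by $L_0(x,t)=1$, $L_1(x,t)=x$ and $L_n(x,t)=xL_{n-1}(x,t)-\tau_{n-2}(t)L_{n-2}(x,t)$ for $n\ge 2$, and set $S_n(x,t)=\frac{L_{2n+1}(\sqrt{x},t)}{\sqrt{x}}$. Then for every $n\ge 0$, $$S_n(x,t)=\frac{1}{1+t^n}\sum_{k=0}^n(-1)^{n-k}G_{n,k}(t)\,x^k,$$ where $$G_{n,k}(t)=\sum_{j=0}^{n-k}\frac{\binom{j+k}{k}\binom{n-j-1}{k-1}\,\bigl(n(k+1)-j\bigr)}{k(k+1)}\bigl(t^j+t^{2n-k-j}\bigr)\quad\text{for }1\le k\le n,$$ and $$G_{n,0}(t)=(2n+1)t^n+\sum_{j=0}^{2n}t^j.$$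
   Context: Since only odd-index $L$'s are involved, $L_{2n+1}(x,t)$ is $x$ times a polynomial in $x^2$, so $S_n(x,t)$ is a polynomial in $x$ of degree $n$. *)

theory Defs
  imports
    "HOL-Computational_Algebra.Polynomial"
    "HOL-Computational_Algebra.Fraction_Field"
begin

type_synonym ratfun = "rat poly fract"

definition tvar :: ratfun where
  "tvar = Fract [:0, 1:] 1"

definition tau :: "nat \<Rightarrow> ratfun" where
  "tau m =
     (let n = m div 2 in
      if m = 0 then 1 + tvar
      else if even m then (1 + tvar ^ (n + 1)) / (1 + tvar ^ n)
      else tvar * (1 + tvar ^ n) / (1 + tvar ^ (n + 1)))"

fun L :: "nat \<Rightarrow> ratfun poly" where
  "L 0 = 1"
| "L (Suc 0) = [:0, 1:]"
| "L (Suc (Suc n)) = [:0, 1:] * L (Suc n) - smult (tau n) (L n)"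

text \<open>
  With \<open>y\<close> for the square root of \<open>x\<close>, the equation
  \<open>S\<^sub>n(x) = L\<^sub>2\<^sub>n\<^sub>+\<^sub>1(y) / y\<close> is an identity in the polynomial ring in \<open>y\<close>: it says
  \<open>y S\<^sub>n(y\<^sup>2) = L\<^sub>2\<^sub>n\<^sub>+\<^sub>1(y)\<close>. Lemma \<open>S_unique_existence\<close> shows that it determines \<open>S\<^sub>n\<close>.
\<close>

definition S :: "nat \<Rightarrow> ratfun poly" where
  "S n = (THE p. [:0, 1:] * pcompose p ([:0, 1:] ^ 2) = L (2 * n + 1))"

lemma S_unique_existence:
  "\<exists>!p. [:0, 1:] * pcompose p ([:0, 1:] ^ 2) = L (2 * n + 1)"
proof -
  let ?X = "[:0, 1:] :: ratfun poly"
  have X2: "?X ^ 2 = [:0, 0, 1:]"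
    by (simp add: power2_eq_square)
  have ex: "(\<exists>q. pcompose q (?X ^ 2) = L (2 * n)) \<and>
            (\<exists>p. ?X * pcompose p (?X ^ 2) = L (2 * n + 1))"
  proof (induction n)
    case 0
    have "pcompose 1 (?X ^ 2) = L (2 * 0)"
      by (simp add: pcompose_1)
    moreover have "?X * pcompose 1 (?X ^ 2) = L (2 * 0 + 1)"
      by (simp add: pcompose_1)
    ultimately show ?case by blast
  next
    case (Suc n)
    then obtain p q
      where q: "pcompose q (?X ^ 2) = L (2 * n)"
        and p: "?X * pcompose p (?X ^ 2) = L (2 * n + 1)"
      by blast
    define q' where "q' = ?X * p - smult (tau (2 * n)) q"
    define p' where "p' = q' - smult (tau (2 * n + 1)) p"
    have X: "pcompose ?X (?X ^ 2) = ?X ^ 2"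
      by (simp add: pcompose_pCons)
    have "pcompose q' (?X ^ 2) = ?X * (?X * pcompose p (?X ^ 2)) - smult (tau (2 * n)) (pcompose q (?X ^ 2))"
      unfolding q'_def pcompose_diff pcompose_mult pcompose_smult X
      by (simp only: power2_eq_square mult.assoc)
    also have "\<dots> = L (2 * Suc n)"
      unfolding p q by simp
    finally have q': "pcompose q' (?X ^ 2) = L (2 * Suc n)" .
    have "?X * pcompose p' (?X ^ 2) =
        ?X * pcompose q' (?X ^ 2) - smult (tau (2 * n + 1)) (?X * pcompose p (?X ^ 2))"
      unfolding p'_def pcompose_diff pcompose_smult
      by (simp only: right_diff_distrib mult_smult_right)
    also have "\<dots> = L (2 * Suc n + 1)"
      unfolding p q' by simp
    finally show ?case using q' by blast
  qed
  have uniq: "p = q"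
    if "?X * pcompose p (?X ^ 2) = ?X * pcompose q (?X ^ 2)" for p q
  proof -
    have "pcompose p (?X ^ 2) = pcompose q (?X ^ 2)"
      using that by (metis mult_left_cancel pCons_eq_0_iff zero_neq_one)
    then have "pcompose (p - q) (?X ^ 2) = 0"
      by (simp only: pcompose_diff diff_self)
    then have "p - q = 0"
      by (rule pcompose_eq_0) (simp add: X2)
    then show ?thesis by simp
  qed
  show ?thesis
    using ex uniq by (metis (no_types, lifting))
qed

definition G :: "nat \<Rightarrow> nat \<Rightarrow> ratfun" where
  "G n k =
     (if k = 0 then of_nat (2 * n + 1) * tvar ^ n + (\<Sum>j\<le>2 * n. tvar ^ j)
      else \<Sum>j=0..n - k.
        of_nat ((j + k) choose k) * of_nat ((n - j - 1) choose (k - 1))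
          * (of_nat n * (of_nat k + 1) - of_nat j) / (of_nat k * (of_nat k + 1))
          * (tvar ^ j + tvar ^ (2 * n - k - j)))"

end

theory Submission
  imports Defs "HOL-Computational_Algebra.Formal_Power_Series"
begin

text \<open>
  Put \<open>w\<^sub>n = 1 + t\<^sup>n\<close>. Then \<open>\<tau>\<^sub>2\<^sub>n = w\<^sub>n\<^sub>+\<^sub>1 / w\<^sub>n\<close> and \<open>\<tau>\<^sub>2\<^sub>n\<^sub>+\<^sub>1 = t w\<^sub>n / w\<^sub>n\<^sub>+\<^sub>1\<close> for \<open>n > 0\<close>,
  and \<open>w\<^sub>n\<^sub>+\<^sub>2 = (1 + t) w\<^sub>n\<^sub>+\<^sub>1 - t w\<^sub>n\<close>. Contracting the recurrence of \<open>L\<close> to even indices therefore gives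
  constant coefficients: \<open>L\<^sub>2\<^sub>n(y) = V\<^sub>n(y\<^sup>2)\<close> for \<open>n > 0\<close>, where \<open>V\<^sub>0 = 2\<close>, \<open>V\<^sub>1 = x - 1 - t\<close> and
  \<open>V\<^sub>n\<^sub>+\<^sub>2 = (x - 1 - t) V\<^sub>n\<^sub>+\<^sub>1 - t V\<^sub>n\<close>. The recurrence of \<open>L\<close> then yields
  \<open>x w\<^sub>n S\<^sub>n = w\<^sub>n V\<^sub>n\<^sub>+\<^sub>1 + w\<^sub>n\<^sub>+\<^sub>1 V\<^sub>n\<close>.

  With \<open>D = (1 - s)(1 - t s)\<close> and up to the sign \<open>(-1)\<^sup>n\<^sup>+\<^sup>k\<close>, the coefficient of \<open>x\<^sup>k\<close> in \<open>V\<^sub>n\<close> for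
  \<open>k > 0\<close> is the coefficient of \<open>s\<^sup>n\<close> in \<open>(1 - t s\<^sup>2) s\<^sup>k / D\<^sup>k\<^sup>+\<^sup>1\<close>. Since \<open>(s / D)' = (1 - t s\<^sup>2) / D\<^sup>2\<close>,
  this series is \<open>(s / k) d/ds (s / D)\<^sup>k\<close>, so the coefficient is \<open>n / k\<close> times a convolution of binomial coefficients.
\<close>

unbundle fps_syntax

text \<open>The order by leading coefficients makes every \<open>1 + tvar ^ n\<close> positive,
  hence a legitimate denominator.\<close>

lemma tvar_pos: "tvar > 0"
  unfolding tvar_def by (simp add: zero_less_Fract_iff less_poly_def pos_poly_def)

lemma one_plus_tvar_power_nonzero: "1 + tvar ^ n \<noteq> 0"
  using zero_less_power[OF tvar_pos, of n] by (simp add: add_pos_pos less_imp_neq[symmetric])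

section \<open>Lucas polynomials and their coefficient series\<close>

text \<open>This is \<open>V\<^sub>n\<close>, the sum of the \<open>n\<close>-th powers of the two
  roots of \<open>z^2 - (x - 1 - t) z + t\<close>.\<close>

fun lucas_poly :: "'a :: comm_ring_1 \<Rightarrow> nat \<Rightarrow> 'a poly" where
  "lucas_poly t 0 = 2"
| "lucas_poly t (Suc 0) = [:- 1 - t, 1:]"
| "lucas_poly t (Suc (Suc n)) =
     [:- 1 - t, 1:] * lucas_poly t (Suc n) - smult t (lucas_poly t n)"

definition lucas_denom :: "'a :: field_char_0 \<Rightarrow> 'a fps" where
  "lucas_denom t = (1 - fps_X) * (1 - fps_const t * fps_X)"

definition lucas_kernel :: "'a :: field_char_0 \<Rightarrow> 'a fps" where
  "lucas_kernel t = fps_X * inverse (lucas_denom t)"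

text \<open>
  Column \<open>k\<close> is the series \<open>\<Sum>\<^sub>n (-1)\<^sup>n\<^sup>+\<^sup>k [x\<^sup>k] V\<^sub>n s\<^sup>n\<close>.
\<close>

fun lucas_column :: "'a :: field_char_0 \<Rightarrow> nat \<Rightarrow> 'a fps" where
  "lucas_column t 0 = inverse (1 - fps_X) + inverse (1 - fps_const t * fps_X)"
| "lucas_column t (Suc k) = fps_X * fps_deriv (lucas_kernel t) * lucas_kernel t ^ k"

declare lucas_column.simps [simp del]

lemma lucas_denom_expand:
  "lucas_denom t = 1 - fps_const (1 + t) * fps_X + fps_const t * fps_X ^ 2"
  by (simp add: lucas_denom_def algebra_simps power2_eq_square flip: fps_const_add)

lemma lucas_denom_inverse: "lucas_denom t * inverse (lucas_denom t) = 1"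
  by (rule inverse_mult_eq_1') (simp add: lucas_denom_def)

lemma lucas_kernel_mult_denom: "lucas_kernel t * lucas_denom t = fps_X"
  using lucas_denom_inverse[of t] by (simp add: lucas_kernel_def mult_ac)

text \<open>Differentiating \<open>(s / D) D = s\<close> gives
  \<open>(s / D)' D = (D - s D') / D\<close>.\<close>

lemma fps_deriv_lucas_kernel:
  "fps_deriv (lucas_kernel t) * lucas_denom t = (1 - fps_const t * fps_X ^ 2) * inverse (lucas_denom t)"
proof -
  let ?D = "lucas_denom t" and ?K = "lucas_kernel t"
  have "fps_deriv ?K * ?D + ?K * fps_deriv ?D = 1"
    using arg_cong[OF lucas_kernel_mult_denom, of fps_deriv t] by (simp add: algebra_simps)
  then have "fps_deriv ?K * ?D = 1 - ?K * fps_deriv ?D"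
    by (simp add: algebra_simps)
  also have "\<dots> = (?D - fps_X * fps_deriv ?D) * inverse ?D"
    using lucas_denom_inverse[of t] by (simp add: lucas_kernel_def algebra_simps)
  also have "?D - fps_X * fps_deriv ?D = 1 - fps_const t * fps_X ^ 2"
    by (simp add: lucas_denom_def algebra_simps power2_eq_square)
  finally show ?thesis .
qed

text \<open>For \<open>a = 1 - s\<close> and \<open>b = 1 - t s\<close>, the left side is
  \<open>(a + b - a b) / (a b)\<close>, and
  \<open>a + b - a b = 1 - (1 - a) (1 - b)\<close>.\<close>

lemma lucas_column_0_minus_1:
  "lucas_column t 0 - 1 = (1 - fps_const t * fps_X ^ 2) * inverse (lucas_denom t)"
proof -
  let ?a = "1 - fps_X :: 'a fps" and ?b = "1 - fps_const t * fps_X"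
  have a: "?a * inverse ?a = 1" and b: "?b * inverse ?b = 1"
    by (rule inverse_mult_eq_1', simp)+
  have "(1 - fps_const t * fps_X ^ 2) * inverse (lucas_denom t)
      = (?a + ?b - ?a * ?b) * (inverse ?a * inverse ?b)"
    unfolding lucas_denom_def fps_inverse_mult by (simp add: algebra_simps power2_eq_square)
  also have "\<dots> = (?a * inverse ?a) * inverse ?b + (?b * inverse ?b) * inverse ?a
      - (?a * inverse ?a) * (?b * inverse ?b)"
    by (simp only: ring_distribs mult_ac)
  finally show ?thesis by (simp add: lucas_column.simps a b)
qed

text \<open>Each column is \<open>s / D\<close> times the previous one, which encodes the recurrence
  of \<open>V\<^sub>n\<close>. Column 0 exceeds the pattern by 1 because
  \<open>V\<^sub>0 = 2\<close>.\<close>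

lemma lucas_column_Suc_mult_denom:
  "lucas_column t (Suc k) * lucas_denom t
     = fps_X * (lucas_column t k - (if k = 0 then 1 else 0))"
proof (cases k)
  case 0
  then show ?thesis
    using fps_deriv_lucas_kernel[of t] lucas_column_0_minus_1[of t]
    by (simp add: lucas_column.simps(2) mult.assoc)
next
  case (Suc m)
  then show ?thesis
    using lucas_kernel_mult_denom[of t] by (simp add: lucas_column.simps(2) mult_ac)
qed

lemma lucas_column_0_nth: "lucas_column t 0 $ n = 1 + t ^ n"
  using one_minus_const_fps_X_neg_power'[of 1 t]
  by (simp add: lucas_column.simps fps_inverse_one_minus_fps_X)

lemma lucas_column_Suc_at_0: "lucas_column t (Suc k) $ 0 = 0"
  by (simp add: lucas_column.simps mult.assoc)

lemma lucas_denom_mult_nth_Suc_Suc: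
  "(f * lucas_denom t) $ Suc (Suc n) = f $ Suc (Suc n) - (1 + t) * f $ Suc n + t * f $ n"
proof -
  have "f * lucas_denom t = f - fps_const (1 + t) * (fps_X * f) + fps_const t * (fps_X ^ 2 * f)"
    by (simp add: lucas_denom_expand algebra_simps)
  then show ?thesis
    by (simp add: fps_X_power_mult_nth)
qed

lemma lucas_column_Suc_at_1: "lucas_column t (Suc k) $ Suc 0 = (if k = 0 then 1 else 0)"
proof -
  have "lucas_column t (Suc k) $ Suc 0 = (lucas_column t (Suc k) * lucas_denom t) $ Suc 0"
    using lucas_column_Suc_at_0[of t k]
    by (simp add: fps_mult_nth_1[simplified] lucas_denom_def)
  also have "\<dots> = (if k = 0 then 1 else 0)"
    unfolding lucas_column_Suc_mult_denom
    by (cases k) (simp_all add: lucas_column_0_nth lucas_column_Suc_at_0)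
  finally show ?thesis .
qed

text \<open>After the factor \<open>s\<close>, the correction 1 of column 0 sits at index 1, so it
  does not reach the indices treated here.\<close>

lemma lucas_column_Suc_nth_Suc_Suc:
  "lucas_column t (Suc k) $ Suc (Suc n) = lucas_column t k $ Suc n
     + (1 + t) * lucas_column t (Suc k) $ Suc n - t * lucas_column t (Suc k) $ n"
  using arg_cong[OF lucas_column_Suc_mult_denom, of "\<lambda>f. f $ Suc (Suc n)" t k]
  unfolding lucas_denom_mult_nth_Suc_Suc
  by (cases k) (simp_all add: algebra_simps)

text \<open>The sign turns the factor \<open>x - 1 - t\<close> of the recurrence into
  \<open>x + 1 + t\<close> and preserves the last term, which matches the recurrence of the
  columns.\<close>

lemma coeff_lucas_poly:
  "coeff (lucas_poly t n) k = (- 1) ^ (n + k) * lucas_column t k $ n"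
proof (induction t n arbitrary: k rule: lucas_poly.induct)
  case (1 t)
  have "coeff (2 :: 'a poly) k = (if k = 0 then 2 else 0)"
    by (cases k) (simp_all add: numeral_poly)
  then show ?case
    by (cases k) (simp_all add: lucas_column_0_nth lucas_column_Suc_at_0)
next
  case (2 t)
  show ?case
    by (cases k) (auto simp: lucas_column_0_nth lucas_column_Suc_at_1 coeff_pCons
        split: nat.splits)
next
  case (3 t n)
  show ?case
    by (cases k) (auto simp: lucas_column_0_nth lucas_column_Suc_nth_Suc_Suc 3 algebra_simps)
qed

section \<open>Powers of \<open>s / D\<close> as binomial convolutions\<close>

lemma lucas_kernel_power_nth:
  "lucas_kernel t ^ Suc k $ (n + Suc k)
     = (\<Sum>j=0..n. of_nat ((j + k) choose k) * of_nat ((n - j + k) choose k) * t ^ j)"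
proof -
  \<comment> \<open>Both inverses are negative binomial series; \<open>fps_const 1\<close> gives
    \<open>1 - s\<close> the same shape as \<open>1 - t s\<close>.\<close>
  have "lucas_kernel t ^ Suc k = fps_X ^ Suc k *
      (inverse ((1 - fps_const t * fps_X) ^ Suc k) * inverse ((1 - fps_const 1 * fps_X) ^ Suc k))"
    unfolding lucas_kernel_def lucas_denom_def power_mult_distrib fps_inverse_mult fps_inverse_power
    by (simp add: mult_ac)
  then have "lucas_kernel t ^ Suc k $ (n + Suc k) =
      (inverse ((1 - fps_const t * fps_X) ^ Suc k) * inverse ((1 - fps_const 1 * fps_X) ^ Suc k)) $ n"
    by (simp only: fps_X_power_mult_nth) simp
  also have "\<dots> = (\<Sum>j=0..n. of_nat ((j + k) choose k) * of_nat ((n - j + k) choose k) * t ^ j)"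
    unfolding one_minus_const_fps_X_neg_power'[OF zero_less_Suc] fps_mult_nth
  proof (rule sum.cong[OF refl])
    fix j
    have "(k + i) choose i = (i + k) choose k" for i
      using binomial_symmetric[of i "k + i"] by (simp add: add.commute)
    then show "Abs_fps (\<lambda>i. of_nat (Suc k + i - 1 choose i) * t ^ i) $ j *
        Abs_fps (\<lambda>i. of_nat (Suc k + i - 1 choose i) * 1 ^ i) $ (n - j) =
        of_nat ((j + k) choose k) * of_nat ((n - j + k) choose k) * t ^ j"
      by simp
  qed
  finally show ?thesis .
qed

lemma lucas_column_Suc_nth:
  "of_nat (Suc k) * lucas_column t (Suc k) $ n = of_nat n * lucas_kernel t ^ Suc k $ n"
proof -
  have "of_nat (Suc k) * lucas_column t (Suc k) = fps_X * fps_deriv (lucas_kernel t ^ Suc k)"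
    by (simp only: fps_deriv_power' lucas_column.simps) (simp add: mult_ac)
  from arg_cong[OF this, of "\<lambda>f. f $ n"] show ?thesis
    by (cases n) (simp_all add: fps_mult_of_nat_nth del: power_Suc of_nat_Suc)
qed

lemma lucas_kernel_power_nth_eq_0: "n \<le> k \<Longrightarrow> lucas_kernel t ^ Suc k $ n = 0"
  unfolding lucas_kernel_def power_mult_distrib by (simp only: fps_X_power_mult_nth) simp

lemma lucas_column_Suc_nth_eq_0: "n \<le> k \<Longrightarrow> lucas_column t (Suc k) $ n = 0"
  using lucas_column_Suc_nth[of k t n] lucas_kernel_power_nth_eq_0[of n k t]
  by (simp del: power_Suc of_nat_Suc)

lemma lucas_kernel_power_nth_rev:
  "lucas_kernel t ^ Suc k $ (n + Suc k)
     = (\<Sum>j=0..n. of_nat ((j + k) choose k) * of_nat ((n - j + k) choose k) * t ^ (n - j))"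
  unfolding lucas_kernel_power_nth
  by (subst sum.atLeastAtMost_rev) (auto intro!: sum.cong simp: mult_ac)

text \<open>The convolution itself stops at \<open>m - 1\<close>. The added term at
  \<open>j = m\<close> contains \<open>l choose Suc l = 0\<close>, so the range can agree with that
  of the next coefficient.\<close>

lemma lucas_kernel_power_nth_shift:
  "lucas_kernel t ^ Suc (Suc l) $ (m + Suc l)
     = (\<Sum>j=0..m. of_nat ((j + Suc l) choose Suc l) * of_nat ((m - j + l) choose Suc l) * t ^ j)"
proof (cases m)
  case 0
  then show ?thesis by (simp add: lucas_kernel_power_nth_eq_0 del: power_Suc)
next
  case (Suc p)
  have "lucas_kernel t ^ Suc (Suc l) $ (m + Suc l)
     = (\<Sum>j=0..p. of_nat ((j + Suc l) choose Suc l) * of_nat ((p - j + Suc l) choose Suc l) * t ^ j)"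
    using lucas_kernel_power_nth[of t "Suc l" p] Suc by (simp del: power_Suc binomial_Suc_Suc)
  also have "\<dots> = (\<Sum>j=0..p. of_nat ((j + Suc l) choose Suc l) * of_nat ((m - j + l) choose Suc l) * t ^ j)"
    by (rule sum.cong) (auto simp: Suc Suc_diff_le simp del: binomial_Suc_Suc)
  finally show ?thesis
    by (simp add: Suc del: power_Suc binomial_Suc_Suc)
qed

text \<open>The reversed convolution has exponents \<open>m - 1 - j\<close>; the factor
  \<open>t\<close> raises them to \<open>m - j\<close>.\<close>

lemma lucas_kernel_power_nth_shift_rev:
  "t * lucas_kernel t ^ Suc (Suc l) $ (m + Suc l)
     = (\<Sum>j=0..m. of_nat ((j + Suc l) choose Suc l) * of_nat ((m - j + l) choose Suc l) * t ^ (m - j))"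
proof (cases m)
  case 0
  then show ?thesis by (simp add: lucas_kernel_power_nth_eq_0 del: power_Suc)
next
  case (Suc p)
  have "t * lucas_kernel t ^ Suc (Suc l) $ (m + Suc l)
     = (\<Sum>j=0..p. of_nat ((j + Suc l) choose Suc l) * of_nat ((p - j + Suc l) choose Suc l) * (t * t ^ (p - j)))"
    using lucas_kernel_power_nth_rev[of t "Suc l" p] Suc
    by (simp add: sum_distrib_left mult_ac del: power_Suc binomial_Suc_Suc)
  also have "\<dots> = (\<Sum>j=0..p. of_nat ((j + Suc l) choose Suc l) * of_nat ((m - j + l) choose Suc l) * t ^ (m - j))"
    by (rule sum.cong) (auto simp: Suc Suc_diff_le simp del: binomial_Suc_Suc)
  finally show ?thesis
    by (simp add: Suc del: power_Suc binomial_Suc_Suc)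
qed

text \<open>Absorption and Pascal's rule. This merges two convolutions into the single weight in
  \<open>G\<close>.\<close>

lemma binomial_difference:
  "of_nat (Suc l) * ((of_nat n + 1) * of_nat ((i + Suc l) choose Suc l) - of_nat n * of_nat ((i + l) choose Suc l))
     = (of_nat ((i + l) choose l) * (of_nat n * of_nat (Suc l) + of_nat (i + Suc l)) :: 'a :: comm_ring_1)"
proof -
  have absorb: "of_nat (Suc l) * of_nat ((i + Suc l) choose Suc l)
      = (of_nat (i + Suc l) * of_nat ((i + l) choose l) :: 'a)"
    using Suc_times_binomial[of l "i + l"] by (metis add_Suc_right of_nat_mult)
  have pascal: "of_nat ((i + Suc l) choose Suc l)
      = (of_nat ((i + l) choose l) + of_nat ((i + l) choose Suc l) :: 'a)"
    by simp
  have "of_nat (Suc l) * ((of_nat n + 1) * of_nat ((i + Suc l) choose Suc l) - of_nat n * of_nat ((i + l) choose Suc l))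
     = of_nat (Suc l) * of_nat ((i + Suc l) choose Suc l)
       + of_nat n * of_nat (Suc l) * (of_nat ((i + Suc l) choose Suc l) - of_nat ((i + l) choose Suc l) :: 'a)"
    by (simp only: algebra_simps mult_1_left)
  also have "\<dots> = of_nat ((i + l) choose l) * (of_nat n * of_nat (Suc l) + of_nat (i + Suc l))"
    unfolding absorb unfolding pascal by (simp only: algebra_simps add_diff_cancel_right')
  finally show ?thesis .
qed

section \<open>\<open>G\<close> as a coefficient of \<open>w\<^sub>n V\<^sub>n\<^sub>+\<^sub>1 +
  w\<^sub>n\<^sub>+\<^sub>1 V\<^sub>n\<close>\<close>

text \<open>With \<open>k = Suc l\<close>, the right side is that coefficient at
  \<open>x^(k+1)\<close> up to the sign \<open>(-1)^(n+k)\<close>. Multiplied by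
  \<open>k + 1\<close>, both sides become sums over the same \<open>j\<close> that agree term by
  term.\<close>

lemma G_Suc_eq_lucas_column:
  assumes "Suc l \<le> n"
  shows "G n (Suc l) = (1 + tvar ^ n) * lucas_column tvar (Suc (Suc l)) $ Suc n
           - (1 + tvar ^ Suc n) * lucas_column tvar (Suc (Suc l)) $ n"
proof -
  define m where "m = n - Suc l"
  have n: "n = m + Suc l" using assms by (simp add: m_def)
  let ?k = "Suc l" and ?t = tvar
  let ?K = "lucas_kernel ?t ^ Suc ?k" and ?C = "lucas_column ?t (Suc ?k)"
  let ?a = "\<lambda>j. of_nat ((j + ?k) choose ?k) :: ratfun"
  let ?b = "\<lambda>j. of_nat ((m - j + ?k) choose ?k) :: ratfun"
  let ?c = "\<lambda>j. of_nat ((m - j + l) choose ?k) :: ratfun"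
  let ?e = "\<lambda>j. ?t ^ j + ?t ^ n * ?t ^ (m - j)"
  \<comment> \<open>The convolutions are palindromic in \<open>t\<close>, which produces the mirrored exponent \<open>2n - k - j\<close> of \<open>G\<close>.\<close>
  have K1: "(1 + ?t ^ n) * ?K $ Suc n = (\<Sum>j=0..m. ?a j * ?b j * ?e j)"
    using lucas_kernel_power_nth[of ?t ?k m] lucas_kernel_power_nth_rev[of ?t ?k m]
    by (simp add: n distrib_left distrib_right sum.distrib sum_distrib_left mult_ac
        del: power_Suc binomial_Suc_Suc)
  have "(1 + ?t ^ Suc n) * ?K $ n = ?K $ n + ?t ^ n * (?t * ?K $ n)"
    by (simp add: algebra_simps)
  also have "\<dots> = (\<Sum>j=0..m. ?a j * ?c j * ?e j)"
    unfolding n lucas_kernel_power_nth_shift_rev unfolding lucas_kernel_power_nth_shift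
    by (simp add: distrib_left sum.distrib sum_distrib_left mult_ac
        del: power_Suc binomial_Suc_Suc)
  finally have K2: "(1 + ?t ^ Suc n) * ?K $ n = (\<Sum>j=0..m. ?a j * ?c j * ?e j)" .
  have "of_nat (Suc ?k) * ((1 + ?t ^ n) * ?C $ Suc n - (1 + ?t ^ Suc n) * ?C $ n)
      = (1 + ?t ^ n) * (of_nat (Suc ?k) * ?C $ Suc n) - (1 + ?t ^ Suc n) * (of_nat (Suc ?k) * ?C $ n)"
    by (simp only: algebra_simps)
  also have "\<dots> = of_nat (Suc n) * ((1 + ?t ^ n) * ?K $ Suc n) - of_nat n * ((1 + ?t ^ Suc n) * ?K $ n)"
    unfolding lucas_column_Suc_nth by (simp only: mult_ac)
  also have "\<dots> = (\<Sum>j=0..m. ?a j * ((of_nat n + 1) * ?b j - of_nat n * ?c j) * ?e j)"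
    unfolding K1 K2 sum_distrib_left sum_subtractf[symmetric]
    by (rule sum.cong) (simp_all only: algebra_simps of_nat_Suc)
  finally have main: "of_nat (Suc ?k) * ((1 + ?t ^ n) * ?C $ Suc n - (1 + ?t ^ Suc n) * ?C $ n)
      = (\<Sum>j=0..m. ?a j * ((of_nat n + 1) * ?b j - of_nat n * ?c j) * ?e j)" .
  have "of_nat (Suc ?k) * G n ?k = (\<Sum>j=0..m. ?a j * ((of_nat n + 1) * ?b j - of_nat n * ?c j) * ?e j)"
  proof -
    have "of_nat (Suc ?k) * (?a j * of_nat ((n - j - 1) choose (?k - 1))
          * (of_nat n * (of_nat ?k + 1) - of_nat j) / (of_nat ?k * (of_nat ?k + 1))
          * (?t ^ j + ?t ^ (2 * n - ?k - j)))
        = ?a j * ((of_nat n + 1) * ?b j - of_nat n * ?c j) * ?e j" if "j \<le> m" for j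
    proof -
      define i where "i = m - j"
      have idx: "n - j - 1 = i + l" "2 * n - ?k - j = n + i" and nij: "n = i + ?k + j"
        using that by (simp_all add: i_def n)
      have k: "of_nat ?k \<noteq> (0 :: ratfun)" "of_nat ?k + 1 \<noteq> (0 :: ratfun)"
        using of_nat_neq_0[of l, where 'a = ratfun] of_nat_neq_0[of ?k, where 'a = ratfun]
        by (simp_all add: add.commute)
      \<comment> \<open>Since \<open>n = i + k + j\<close>, the weight in \<open>G\<close> takes the
        form that occurs in \<open>binomial_difference\<close>.\<close>
      have num: "of_nat n * (of_nat ?k + 1) - of_nat j = (of_nat n * of_nat ?k + of_nat (i + ?k) :: ratfun)"
        by (simp add: nij algebra_simps)
      let ?d = "(of_nat n + 1) * ?b j - of_nat n * ?c j"
      have d: "of_nat ((i + l) choose l) * (of_nat n * of_nat ?k + of_nat (i + ?k)) = of_nat ?k * ?d"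
        unfolding i_def by (rule binomial_difference[symmetric])
      have "of_nat (Suc ?k) * (?a j * of_nat ((n - j - 1) choose (?k - 1))
          * (of_nat n * (of_nat ?k + 1) - of_nat j) / (of_nat ?k * (of_nat ?k + 1))
          * (?t ^ j + ?t ^ (2 * n - ?k - j)))
        = (of_nat ?k + 1) * (?a j * (of_nat ((i + l) choose l) * (of_nat n * of_nat ?k + of_nat (i + ?k)))
          / (of_nat ?k * (of_nat ?k + 1)) * ?e j)"
        unfolding num idx by (simp only: of_nat_Suc[of ?k] power_add i_def diff_Suc_1 mult.assoc add.commute)
      also have "\<dots> = ?a j * ?d * ?e j"
        unfolding d using k by (simp del: of_nat_Suc binomial_Suc_Suc)
      finally show ?thesis .
    qed
    then show ?thesis
      unfolding G_def m_def by (simp add: sum_distrib_left del: of_nat_Suc binomial_Suc_Suc)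
  qed
  with main have "of_nat (Suc ?k) * G n ?k
      = of_nat (Suc ?k) * ((1 + ?t ^ n) * ?C $ Suc n - (1 + ?t ^ Suc n) * ?C $ n)"
    by simp
  then show ?thesis
    by (simp del: of_nat_Suc power_Suc)
qed

lemma lucas_column_1_nth: "lucas_column t (Suc 0) $ n = of_nat n * (\<Sum>j<n. t ^ j)"
proof (cases n)
  case (Suc m)
  then show ?thesis
    using lucas_column_Suc_nth[of 0 t n] lucas_kernel_power_nth[of t 0 m]
    by (simp add: lessThan_Suc_atMost atMost_atLeast0)
qed (simp add: lucas_column_Suc_at_0)

lemma sum_lessThan_add:
  "(\<Sum>j<a + (b :: nat). f j) = (\<Sum>j<a. f j) + (\<Sum>j<b. f (a + j) :: 'a :: comm_monoid_add)"
  by (induction b) (simp_all add: add.assoc)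

text \<open>The formula for positive \<open>k\<close> divides by \<open>k\<close>, so the constant
  term is computed separately, from the geometric sums in column 1.\<close>

lemma G_0_eq_lucas_column:
  "G n 0 = (1 + tvar ^ n) * lucas_column tvar (Suc 0) $ Suc n
     - (1 + tvar ^ Suc n) * lucas_column tvar (Suc 0) $ n"
proof -
  define s where "s = (\<Sum>j<n. tvar ^ j)"
  have geometric: "tvar * s = s + tvar ^ n - 1"
  proof -
    have "1 + tvar * s = (\<Sum>j<Suc n. tvar ^ j)"
      unfolding s_def sum.lessThan_Suc_shift by (simp add: sum_distrib_left)
    then show ?thesis by (simp add: s_def algebra_simps)
  qed
  have "(\<Sum>j\<le>2 * n. tvar ^ j) = (\<Sum>j<n + Suc n. tvar ^ j)"
    by (simp add: lessThan_Suc_atMost mult_2)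
  also have "\<dots> = s + (\<Sum>j<Suc n. tvar ^ (n + j))"
    unfolding s_def by (rule sum_lessThan_add)
  also have "\<dots> = s + tvar ^ n * (s + tvar ^ n)"
    by (simp add: s_def power_add sum_distrib_left distrib_left)
  finally have "G n 0 = of_nat (2 * n + 1) * tvar ^ n + (s + tvar ^ n * (s + tvar ^ n))"
    by (simp add: G_def)
  moreover have "(1 + tvar ^ Suc n) * (of_nat n * s) = of_nat n * s + of_nat n * tvar ^ n * (tvar * s)"
    by (simp add: algebra_simps)
  ultimately show ?thesis
    unfolding lucas_column_1_nth s_def[symmetric] geometric sum.lessThan_Suc
    by (simp add: algebra_simps)
qed

lemma G_eq_lucas_column:
  assumes "k \<le> n"
  shows "G n k = (1 + tvar ^ n) * lucas_column tvar (Suc k) $ Suc n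
           - (1 + tvar ^ Suc n) * lucas_column tvar (Suc k) $ n"
  using G_0_eq_lucas_column G_Suc_eq_lucas_column assms by (cases k) blast+

section \<open>The closed form satisfies the recurrence of \<open>L\<close>\<close>

definition S_numerator :: "nat \<Rightarrow> ratfun poly" where
  "S_numerator n = (\<Sum>k=0..n. monom ((- 1) ^ (n - k) * G n k) k)"

lemma coeff_S_numerator:
  "coeff (S_numerator n) k = (if k \<le> n then (- 1) ^ (n + k) * G n k else 0)"
proof -
  have "(- 1 :: ratfun) ^ (n - k) = (- 1) ^ (n + k)" if "k \<le> n"
    using that by (simp add: minus_one_power_iff)
  then show ?thesis
    by (simp add: S_numerator_def coeff_sum)
qed

lemma X_mult_S_numerator:
  "[:0, 1:] * S_numerator n
     = smult (1 + tvar ^ n) (lucas_poly tvar (Suc n)) + smult (1 + tvar ^ Suc n) (lucas_poly tvar n)"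
proof (rule poly_eqI)
  fix i
  show "coeff ([:0, 1:] * S_numerator n) i = coeff (smult (1 + tvar ^ n) (lucas_poly tvar (Suc n))
      + smult (1 + tvar ^ Suc n) (lucas_poly tvar n)) i"
  proof (cases i)
    \<comment> \<open>The two contributions are \<open>w\<^sub>n w\<^sub>n\<^sub>+\<^sub>1\<close>
      with opposite signs.\<close>
    case 0
    then show ?thesis
      by (simp add: coeff_lucas_poly lucas_column_0_nth del: lucas_poly.simps)
  next
    case (Suc k)
    show ?thesis
    proof (cases "k \<le> n")
      case True
      then show ?thesis
        using Suc by (simp add: coeff_S_numerator coeff_lucas_poly G_eq_lucas_column algebra_simps
            del: lucas_poly.simps)
    next
      case False
      then show ?thesis
        using Suc by (simp add: coeff_S_numerator coeff_lucas_poly lucas_column_Suc_nth_eq_0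
            del: lucas_poly.simps)
    qed
  qed
qed

definition S_closed :: "nat \<Rightarrow> ratfun poly" where
  "S_closed n = smult (1 / (1 + tvar ^ n)) (S_numerator n)"

lemma X_mult_S_closed:
  "[:0, 1:] * S_closed n = lucas_poly tvar (Suc n)
     + smult ((1 + tvar ^ Suc n) / (1 + tvar ^ n)) (lucas_poly tvar n)"
proof -
  have "[:0, 1:] * S_closed n = smult (1 / (1 + tvar ^ n)) ([:0, 1:] * S_numerator n)"
    by (simp add: S_closed_def)
  then show ?thesis
    unfolding X_mult_S_numerator smult_add_right
    using one_plus_tvar_power_nonzero[of n] by (simp del: lucas_poly.simps)
qed

lemma tau_even: "0 < n \<Longrightarrow> tau (2 * n) = (1 + tvar ^ Suc n) / (1 + tvar ^ n)"
  by (simp add: tau_def Let_def)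

lemma tau_odd: "tau (Suc (2 * n)) = tvar * (1 + tvar ^ n) / (1 + tvar ^ Suc n)"
  by (simp add: tau_def Let_def)

text \<open>This is the odd step of the recurrence of \<open>L\<close> with \<open>x = y^2\<close>
  and one factor \<open>y\<close> cancelled. Multiplying by \<open>x\<close> makes
  \<open>X_mult_S_closed\<close> applicable on both sides.\<close>

lemma S_closed_Suc:
  "S_closed (Suc n) = lucas_poly tvar (Suc n) - smult (tau (Suc (2 * n))) (S_closed n)"
proof -
  let ?X = "[:0, 1:] :: ratfun poly" and ?V = "lucas_poly tvar" and ?w = "\<lambda>n. 1 + tvar ^ n"
  \<comment> \<open>This is \<open>w\<^sub>n\<^sub>+\<^sub>2 = (1 + t) w\<^sub>n\<^sub>+\<^sub>1 - t
    w\<^sub>n\<close> divided by \<open>w\<^sub>n\<^sub>+\<^sub>1\<close>.\<close>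
  have w: "?w (Suc (Suc n)) / ?w (Suc n) = 1 + tvar - tau (Suc (2 * n))"
    unfolding tau_odd using one_plus_tvar_power_nonzero[of "Suc n"] by (simp add: field_simps)
  have t: "tau (Suc (2 * n)) * (?w (Suc n) / ?w n) = tvar"
    using one_plus_tvar_power_nonzero[of "Suc n"] one_plus_tvar_power_nonzero[of n]
    by (simp add: tau_odd)
  have "?X * S_closed (Suc n) = ?V (Suc (Suc n)) + smult (1 + tvar - tau (Suc (2 * n))) (?V (Suc n))"
    unfolding X_mult_S_closed w ..
  also have "\<dots> = ?X * ?V (Suc n) - smult (tau (Suc (2 * n))) (?V (Suc n)) - smult tvar (?V n)"
    by (simp add: smult_diff_left smult_add_left algebra_simps)
  also have "\<dots> = ?X * ?V (Suc n) - smult (tau (Suc (2 * n))) (?X * S_closed n)"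
    unfolding X_mult_S_closed smult_add_right smult_smult t by simp
  also have "\<dots> = ?X * (?V (Suc n) - smult (tau (Suc (2 * n))) (S_closed n))"
    by (simp add: right_diff_distrib)
  finally show ?thesis
    by (metis mult_left_cancel pCons_eq_0_iff zero_neq_one)
qed

text \<open>In the even step, \<open>X_mult_S_closed\<close> splits \<open>y L (2 * n + 1)\<close>
  into \<open>V\<^sub>n\<^sub>+\<^sub>1\<close> and exactly the term that the recurrence subtracts;
  the odd step is \<open>S_closed_Suc\<close>.\<close>

lemma L_eq_pcompose:
  "L (2 * n) = (if n = 0 then 1 else pcompose (lucas_poly tvar n) ([:0, 1:] ^ 2))
   \<and> L (Suc (2 * n)) = [:0, 1:] * pcompose (S_closed n) ([:0, 1:] ^ 2)"
proof (induction n)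
  case 0
  have "S_closed 0 = 1"
    by (simp add: S_closed_def S_numerator_def G_def smult_monom monom_0 one_pCons)
  then show ?case by (simp add: pcompose_1)
next
  case (Suc n)
  let ?X = "[:0, 1:] :: ratfun poly"
  have X: "pcompose ?X (?X ^ 2) = ?X ^ 2"
    by (simp add: pcompose_pCons)
  have even_part: "smult (tau (2 * n)) (L (2 * n)) =
      pcompose (smult ((1 + tvar ^ Suc n) / (1 + tvar ^ n)) (lucas_poly tvar n)) (?X ^ 2)"
  \<comment> \<open>For \<open>n = 0\<close>, \<open>tau 0 = 1 + t\<close> is twice
    \<open>w\<^sub>1 / w\<^sub>0\<close>, which compensates for \<open>V\<^sub>0 = 2\<close> against
    \<open>L 0 = 1\<close>.\<close>
  proof (cases "n = 0")
    case True
    then show ?thesis by (simp add: tau_def pcompose_smult numeral_poly)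
  next
    case False
    then show ?thesis using Suc.IH by (simp only: tau_even pcompose_smult) simp
  qed
  have "L (2 * Suc n) = ?X * L (Suc (2 * n)) - smult (tau (2 * n)) (L (2 * n))"
    by simp
  also have "?X * L (Suc (2 * n)) = pcompose (?X * S_closed n) (?X ^ 2)"
    using Suc.IH unfolding pcompose_mult X by (simp only: power2_eq_square mult.assoc)
  finally have L_even: "L (2 * Suc n) = pcompose (lucas_poly tvar (Suc n)) (?X ^ 2)"
    unfolding even_part X_mult_S_closed pcompose_add by simp
  have "L (Suc (2 * Suc n)) = ?X * L (2 * Suc n) - smult (tau (Suc (2 * n))) (L (Suc (2 * n)))"
    by simp
  also have "\<dots> = ?X * pcompose (S_closed (Suc n)) (?X ^ 2)"
    using Suc.IH unfolding L_even S_closed_Suc pcompose_diff pcompose_smult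
    by (simp only: right_diff_distrib mult_smult_right)
  finally show ?case using L_even by simp
qed

theorem theorem3:
  fixes n :: nat
  shows "S n = smult (1 / (1 + tvar ^ n))
                 (\<Sum>k=0..n. monom ((-1) ^ (n - k) * G n k) k)"
proof -
  have "[:0, 1:] * pcompose (S_closed n) ([:0, 1:] ^ 2) = L (2 * n + 1)"
    using L_eq_pcompose[of n] by simp
  then have "S n = S_closed n"
    unfolding S_def by (rule the1_equality[OF S_unique_existence])
  then show ?thesis by (simp only: S_closed_def S_numerator_def)
qed

end
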